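(* Let $n\ge2$, let $w_1,\dots,w_n$ be positive integers, let $I$ be an index set, and let $a_1,\dots,a_n:I\to\mathbb Q_{>0}$ be functions. Let $\mathscr Y$ be the visibility datum consisting of the branches $$\phi_\alpha(t)=\bigl(a_1(\alpha)t^{w_1},\dots,a_n(\alpha)t^{w_n}\bigr)\qquad(\alpha\in I),$$ defined for all $t>0$. Set $W=w_1+\cdots+w_n$ and assume that (i) $\gcd(w_1,\dots,w_n)=1$, and (ii) $\mathcal B(\mathscr Y)=\mathbb Z_{\ge1}^n$. Then, for every prime $p$, the relative density of $p$-adically visible points is $$\mathfrak d_p^{\mathrm{vis}}(\mathscr Y)=1-\frac1{p^W}.$$ Moreover, the relative density of globally visible points is $$\mathfrak d^{\mathrm{vis}}(\mathscr Y)=\frac1{\zeta(W)}.$$ (In particular, both densities exist.)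
   Context: That the family $\mathscr Y=\{\phi_\alpha\}_{\alpha\in I}$ is a visibility datum means here that each $\phi_\alpha$ is injective on $\mathbb R_{>0}$, $\phi_\alpha(t)=0$ only for $t=0$, and the images $\phi_\alpha(\mathbb R_{>0})$ and $\phi_\beta(\mathbb R_{>0})$ are disjoint for $\alpha\ne\beta$. The branch locus is $\mathcal B(\mathscr Y)=\{\phi_\alpha(t)\in\mathbb Z^n:\alpha\in I,\ t\in\mathbb R_{>0}\}$. For $P\in\mathbb Z^n$ and a prime $p$, $v_p(P):=\min_i v_p(P_i)$. A point $\phi_\alpha(t)\in\mathcal B(\mathscr Y)$, $t>0$, is globally visible if there is no real $s$ with $0<s<t$ and $\phi_\alpha(s)\in\mathbb Z^n$; it is $p$-adically visible if $v_p(\phi_\alpha(t))\le v_p(\phi_\alpha(s))$ for every real $s$ with $0<s<t$ and $\phi_\alpha(s)\in\mathbb Z^n$. For $P\in\mathbb Z^n$ put $H(P)=\max_i|P_i|$, and let $\mathcal B(\mathscr Y;X)=\{P\in\mathcal B(\mathscr Y):H(P)\le X\}$. The relative density of $\mathcal S\subseteq\mathcal B(\mathscr Y)$ is $\lim_{X\to\infty}\#(\mathcal S\cap\mathcal B(\mathscr Y;X))/\#\mathcal B(\mathscr Y;X)$ when the limit exists. $\mathfrak d^{\mathrm{vis}}(\mathscr Y)$ and $\mathfrak d^{\mathrm{vis}}_p(\mathscr Y)$ are the relative densities of the sets of globally visible and of $p$-adically visible points. $\zeta$ is the Riemann zeta function. *)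

theory Defs
  imports
    "HOL-Analysis.Analysis"
    "HOL-Computational_Algebra.Primes"
    "HOL-Library.Extended_Nat"
begin

(* Integral points are kept as vectors of integers and compared with points on the branches
   through this embedding of Z^n into R^n. *)
definition real_vec :: "int ^ 'n \<Rightarrow> real ^ 'n" where
  "real_vec P = (\<chi> i. real_of_int (P $ i))"

(* A family of branches is a function \<phi> together with an index set I; only the values
   \<phi> \<alpha> t with \<alpha> \<in> I and t > 0 matter (t = 0 is the excluded base point). *)
definition visibility_datum :: "'i set \<Rightarrow> ('i \<Rightarrow> real \<Rightarrow> real ^ 'n) \<Rightarrow> bool" where
  "visibility_datum I \<phi> \<longleftrightarrow>
     (\<forall>\<alpha>\<in>I. inj_on (\<phi> \<alpha>) {0<..}) \<and>
     (\<forall>\<alpha>\<in>I. \<forall>t\<ge>0. \<phi> \<alpha> t = 0 \<longrightarrow> t = 0) \<and>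
     (\<forall>\<alpha>\<in>I. \<forall>\<beta>\<in>I. \<alpha> \<noteq> \<beta> \<longrightarrow> \<phi> \<alpha> ` {0<..} \<inter> \<phi> \<beta> ` {0<..} = {})"

definition branch_locus :: "'i set \<Rightarrow> ('i \<Rightarrow> real \<Rightarrow> real ^ 'n) \<Rightarrow> (int ^ 'n) set" where
  "branch_locus I \<phi> = {P. \<exists>\<alpha>\<in>I. \<exists>t>0. \<phi> \<alpha> t = real_vec P}"

(* Extended-valued because v_p(0) is infinite, whereas multiplicity p 0 = 0. *)
definition int_val :: "nat \<Rightarrow> int \<Rightarrow> enat" where
  "int_val p x = (if x = 0 then \<infinity> else enat (multiplicity (int p) x))"

definition point_val :: "nat \<Rightarrow> int ^ 'n \<Rightarrow> enat" where
  "point_val p P = Min (range (\<lambda>i. int_val p (P $ i)))"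

(* For a visibility datum the pair (\<alpha>, t) with \<phi> \<alpha> t = P is unique, so the existential
   quantifiers below merely name the branch and the parameter of P. *)
definition globally_visible :: "'i set \<Rightarrow> ('i \<Rightarrow> real \<Rightarrow> real ^ 'n) \<Rightarrow> (int ^ 'n) set" where
  "globally_visible I \<phi> =
     {P. \<exists>\<alpha>\<in>I. \<exists>t>0. \<phi> \<alpha> t = real_vec P \<and>
           \<not> (\<exists>s Q. 0 < s \<and> s < t \<and> \<phi> \<alpha> s = real_vec Q)}"

definition padically_visible ::
  "nat \<Rightarrow> 'i set \<Rightarrow> ('i \<Rightarrow> real \<Rightarrow> real ^ 'n) \<Rightarrow> (int ^ 'n) set" where
  "padically_visible p I \<phi> =
     {P. \<exists>\<alpha>\<in>I. \<exists>t>0. \<phi> \<alpha> t = real_vec P \<and>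
           (\<forall>s Q. 0 < s \<and> s < t \<and> \<phi> \<alpha> s = real_vec Q \<longrightarrow> point_val p P \<le> point_val p Q)}"

definition height :: "int ^ 'n \<Rightarrow> int" where
  "height P = Max (range (\<lambda>i. \<bar>P $ i\<bar>))"

definition branch_locus_upto ::
  "'i set \<Rightarrow> ('i \<Rightarrow> real \<Rightarrow> real ^ 'n) \<Rightarrow> real \<Rightarrow> (int ^ 'n) set" where
  "branch_locus_upto I \<phi> X = {P \<in> branch_locus I \<phi>. real_of_int (height P) \<le> X}"

(* "The relative density of S exists and equals d". *)
definition has_relative_density ::
  "'i set \<Rightarrow> ('i \<Rightarrow> real \<Rightarrow> real ^ 'n) \<Rightarrow> (int ^ 'n) set \<Rightarrow> real \<Rightarrow> bool" where
  "has_relative_density I \<phi> S d \<longleftrightarrow>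
     ((\<lambda>X. real (card (S \<inter> branch_locus_upto I \<phi> X)) / real (card (branch_locus_upto I \<phi> X)))
        \<longlongrightarrow> d) at_top"

definition monomial_branch ::
  "('n \<Rightarrow> nat) \<Rightarrow> ('n \<Rightarrow> 'i \<Rightarrow> rat) \<Rightarrow> 'i \<Rightarrow> real \<Rightarrow> real ^ 'n" where
  "monomial_branch w a \<alpha> t = (\<chi> i. of_rat (a i \<alpha>) * t ^ w i)"

(* The Riemann zeta function on its half-line s > 1 of convergence (junk value elsewhere). *)
definition riemann_zeta :: "real \<Rightarrow> real" where
  "riemann_zeta s = (\<Sum>k. 1 / real (Suc k) powr s)"

end

theory Submission
  imports Defs "HOL-Computational_Algebra.Squarefree"
begin

text \<open>A positive integer \<open>k\<close> acts on integral points by \<open>k ^ w i\<close> on the \<open>i\<close>-th coordinate, which on every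
  branch is the substitution \<open>t \<mapsto> k * t\<close>. Visibility turns out to be divisibility with respect to this
  action. Indeed, let \<open>P\<close> and \<open>Q\<close> be integral points on one branch with parameters \<open>t > s\<close>. Then
  \<open>(t / s) ^ w i = P $ i / Q $ i\<close> is rational for all \<open>i\<close>; as the weights have greatest common
  divisor 1, \<open>t / s\<close> is rational, and if \<open>c\<close> is its numerator in lowest terms, then \<open>c ^ w i\<close>
  divides \<open>P $ i\<close> for all \<open>i\<close> (\<open>monomial_branch_ratio\<close>). Hence \<open>P\<close> is globally visible iff no
  \<open>k \<ge> 2\<close> divides it in the weighted sense (\<open>globally_visible_eq\<close>), and \<open>p\<close>-adically visible iff \<open>p\<close>
  does not divide it (\<open>padically_visible_eq\<close>): on the way from \<open>P\<close> to \<open>Q\<close> the valuation can only drop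
  if \<open>p\<close> divides \<open>c\<close>.

  Since the branch locus consists of all positive points, the densities are limits of proportions in
  the boxes \<open>{1..N} ^ n\<close>, where \<open>n\<close> is the number of coordinates; let \<open>W\<close> be the sum of the weights. The weighted multiples of \<open>k\<close> in a box number \<open>\<Prod>i. N div k ^ w i\<close>, so they
  have density \<open>1 / k ^ W\<close> (\<open>density_weighted_multiples\<close>), which settles the \<open>p\<close>-adic case by taking
  complements.

  In the global case, the \<open>k\<close> dividing a fixed \<open>P\<close> are exactly the divisors of one positive integer,
  so Moebius inversion expresses the number of visible points in a box as the sum of \<open>\<mu>(k)\<close> times
  the number of weighted multiples of \<open>k\<close> (\<open>card_weighted_primitive\<close>). Each term, divided by
  \<open>N ^ n\<close>, is bounded by \<open>1 / k ^ W\<close> uniformly in \<open>N\<close>, and \<open>W \<ge> 2\<close>, so the limit may be taken term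
  by term. It is the series of \<open>\<mu>(k) / k ^ W\<close>, the reciprocal of \<open>\<zeta>(W)\<close>
  (\<open>moebius_times_zeta\<close>).\<close>

section \<open>The Moebius function and the zeta series\<close>

definition moebius_mu :: "nat \<Rightarrow> real" where
  "moebius_mu n = (if squarefree n then (-1) ^ card (prime_factors n) else 0)"

lemma abs_moebius_le_1: "\<bar>moebius_mu n\<bar> \<le> 1"
  by (simp add: moebius_mu_def power_abs)

lemma moebius_prime_mult:
  assumes p: "prime p" and nd: "\<not> p dvd d"
  shows "moebius_mu (p * d) = - moebius_mu d"
proof (cases "d = 0")
  case False
  have "squarefree (p * d) \<longleftrightarrow> squarefree d"
    using p nd by (metis dvd_triv_right prime_imp_coprime squarefree_mono squarefree_mult_coprime squarefree_prime)
  moreover have "prime_factors (p * d) = insert p (prime_factors d)"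
    using p False by (auto simp: prime_factors_product prime_gt_0_nat prime_factorization_prime)
  moreover have "p \<notin> prime_factors d" using nd by auto
  ultimately show ?thesis by (simp add: moebius_mu_def)
qed (use nd in auto)

lemma moebius_prime_mult_eq_0:
  assumes p: "prime p" and nd: "p dvd d"
  shows "moebius_mu (p * d) = 0"
proof -
  have "p ^ 2 dvd p * d" using nd by (simp add: power2_eq_square)
  moreover have "\<not> p dvd 1" using p by auto
  ultimately have "\<not> squarefree (p * d)" by (metis squarefreeD)
  then show ?thesis by (simp add: moebius_mu_def)
qed

text \<open>For \<open>m > 1\<close> and a prime \<open>p\<close> dividing \<open>m\<close>, the squarefree divisors of \<open>m\<close> pair off as \<open>d\<close>, \<open>p * d\<close>
  with \<open>p\<close> not dividing \<open>d\<close>, and the two members of a pair have opposite signs.\<close>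
lemma sum_moebius_divisors:
  assumes "m > 0"
  shows "(\<Sum>d | d dvd m. moebius_mu d) = (if m = 1 then 1 else 0)"
proof (cases "m = 1")
  case False
  then obtain p where p: "prime p" "p dvd m" using prime_factor_nat by blast
  then obtain e where e: "m = p * e" by auto
  have p0: "p > 0" using p prime_gt_0_nat by auto
  have fin: "finite {d. d dvd m}" using assms by simp
  have e0: "e > 0" using e assms by auto
  have "d dvd m \<longleftrightarrow> d dvd e" if "\<not> p dvd d" for d
    using prime_imp_coprime[OF p(1) that] by (simp add: e coprime_dvd_mult_right_iff coprime_commute)
  then have eq: "{d. d dvd m \<and> \<not> p dvd d} = {d. d dvd e \<and> \<not> p dvd d}" by blast
  have "(\<Sum>d | d dvd m. moebius_mu d) = (\<Sum>d | d dvd m \<and> \<not> p dvd d. moebius_mu d) + (\<Sum>d | d dvd m \<and> p dvd d. moebius_mu d)"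
    using fin by (subst sum.union_disjoint[symmetric]) (auto intro: sum.cong)
  \<comment> \<open>Every divisor that \<open>p\<close> divides is \<open>p * d\<close> with \<open>d\<close> dividing \<open>e = m / p\<close>; if \<open>p\<close>
    also divides \<open>d\<close>, then \<open>p * d\<close> is not squarefree, and the remaining terms cancel the first sum.\<close>
  also have "(\<Sum>d | d dvd m \<and> p dvd d. moebius_mu d) = (\<Sum>d | d dvd e. moebius_mu (p * d))"
    using p0 e by (intro sum.reindex_bij_betw[symmetric] bij_betwI[of _ _ _ "\<lambda>d. d div p"]) auto
  also have "\<dots> = (\<Sum>d | d dvd e \<and> \<not> p dvd d. - moebius_mu d)"
    using e0 p by (intro sum.mono_neutral_cong_right) (auto simp: moebius_prime_mult moebius_prime_mult_eq_0)
  finally show ?thesis using False eq by (simp add: sum_negf)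
qed (simp add: moebius_mu_def)

text \<open>The Dirichlet product of the coefficients: multiplying out the two absolutely convergent series,
  the coefficient of \<open>1 / m ^ s\<close> is the sum of the Moebius function over the divisors of \<open>m\<close>,
  which vanishes unless \<open>m = 1\<close>.\<close>
lemma moebius_times_zeta:
  assumes s: "s \<ge> 2"
  shows "(\<Sum>k. moebius_mu (Suc k) / real (Suc k) ^ s) * (\<Sum>k. 1 / real (Suc k) ^ s) = 1"
proof -
  define h g where "h = (\<lambda>k. moebius_mu k / real k ^ s)" and "g = (\<lambda>k. 1 / real k ^ s)"
  define M Z where "M = (\<Sum>k. h (Suc k))" and "Z = (\<Sum>k. g (Suc k))"
  let ?A = "{0<..} :: nat set"
  \<comment> \<open>Unordered sums make the rearrangement below legitimate; 0 must be left out of the index set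
    because it has infinitely many divisors.\<close>
  have bij: "bij_betw Suc UNIV ?A"
    by (rule bij_betwI[of _ _ _ "\<lambda>k. k - 1"]) auto
  have sg: "summable (\<lambda>k. g (Suc k))"
    unfolding g_def by (subst summable_Suc_iff) (use inverse_power_summable[OF s, where 'a=real] in \<open>simp add: inverse_eq_divide\<close>)
  have hg: "norm (h k) \<le> g k" for k
    unfolding h_def g_def using abs_moebius_le_1[of k] by (simp add: divide_right_mono)
  have g0: "g k \<ge> 0" for k by (simp add: g_def)
  have sh: "summable (\<lambda>k. norm (h (Suc k)))"
    by (rule summable_comparison_test'[OF sg, of 0]) (use hg in auto)
  have "((\<lambda>k. g (Suc k)) has_sum Z) UNIV"
    unfolding Z_def using sg g0 by (intro norm_summable_imp_has_sum) (auto simp: summable_sums)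
  then have gZ: "(g has_sum Z) ?A" by (simp add: has_sum_reindex_bij_betw[OF bij])
  have "((\<lambda>k. h (Suc k)) has_sum M) UNIV"
    unfolding M_def using sh summable_norm_cancel[OF sh]
    by (intro norm_summable_imp_has_sum) (auto simp: summable_sums)
  then have hM: "(h has_sum M) ?A" by (simp add: has_sum_reindex_bij_betw[OF bij])
  let ?F = "\<lambda>(a, b). h a * g b"
  have "(\<lambda>(a, b). g a * g b) summable_on (?A \<times> ?A)"
    using gZ g0
    by (intro summable_on_SigmaI[where g = "\<lambda>a. g a * Z"])
       (auto intro!: has_sum_cmult_right summable_on_cmult_left mult_nonneg_nonneg dest: has_sum_imp_summable)
  then have "(\<lambda>z. norm (?F z)) summable_on (?A \<times> ?A)"
    by (rule Infinite_Sum.abs_summable_on_comparison_test')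
       (use hg g0 in \<open>auto simp: abs_mult intro!: mult_mono\<close>)
  then have "?F summable_on (?A \<times> ?A)" by (rule abs_summable_summable)
  then have FMZ: "(?F has_sum M * Z) (?A \<times> ?A)"
    using gZ hM
    by (intro has_sum_SigmaI[where g = "\<lambda>a. h a * Z"])
       (auto intro!: has_sum_cmult_right has_sum_cmult_left)
  \<comment> \<open>Group the pairs \<open>(a, b)\<close> by their product \<open>m = a * b\<close>, with \<open>a\<close> running over the divisors of \<open>m\<close>.\<close>
  let ?S = "SIGMA m:?A. {d. d dvd m}"
  have "bij_betw (\<lambda>(m, d). (d, m div d)) ?S (?A \<times> ?A)"
    by (rule bij_betwI[of _ _ _ "\<lambda>(a, b). (a * b, a)"]) (auto intro: Nat.gr0I)
  then have "((\<lambda>(m, d). ?F (d, m div d)) has_sum M * Z) ?S"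
    using FMZ by (subst (asm) has_sum_reindex_bij_betw[symmetric, of "\<lambda>(m, d). (d, m div d)"]) (auto simp: case_prod_unfold)
  also have "?this \<longleftrightarrow> ((\<lambda>(m, d). moebius_mu d / real m ^ s) has_sum M * Z) ?S"
    by (intro has_sum_cong) (auto simp: h_def g_def elim!: dvdE simp: power_mult_distrib)
  finally have "((\<lambda>m. \<Sum>d | d dvd m. moebius_mu d / real m ^ s) has_sum M * Z) ?A"
    by (rule has_sum_SigmaD) (auto intro: has_sum_finite)
  also have "?this \<longleftrightarrow> ((\<lambda>m. if m = 1 then 1 else 0) has_sum M * Z) ?A"
    by (intro has_sum_cong) (simp add: sum_moebius_divisors flip: sum_divide_distrib)
  finally have "((\<lambda>m. if m = 1 then 1 else 0) has_sum M * Z) ?A" .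
  moreover have "((\<lambda>m. if m = 1 then 1 else 0 :: real) has_sum 1) ?A"
    by (rule has_sum_finite_neutralI[of "{1}"]) auto
  ultimately show ?thesis unfolding M_def Z_def h_def g_def using has_sum_unique by blast
qed

section \<open>Weighted divisibility of integral points\<close>

text \<open>A positive integer \<open>k\<close> acts on integral points by \<open>P $ i \<mapsto> k ^ w i * P $ i\<close>, which on a branch is the
  substitution \<open>t \<mapsto> k * t\<close>. The predicate says that \<open>P\<close> lies in the image of \<open>k\<close>, that is, that
  dividing the parameter of \<open>P\<close> by \<open>k\<close> leads to an integral point again.\<close>
definition weighted_dvd :: "('n::finite \<Rightarrow> nat) \<Rightarrow> nat \<Rightarrow> int ^ 'n \<Rightarrow> bool" where
  "weighted_dvd w k P \<longleftrightarrow> (\<forall>i. int (k ^ w i) dvd P $ i)"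

text \<open>With \<open>a = a' * g\<close> and \<open>b = b' * g\<close> for the greatest common divisor \<open>g\<close>, the least common multiple
  divides \<open>a * b'\<close>. After cancelling \<open>g ^ n\<close>, the power of \<open>b'\<close> is coprime to that of \<open>a'\<close>, hence it
  divides the cofactor of \<open>a ^ n\<close> in \<open>x\<close>.\<close>
lemma lcm_power_dvd:
  fixes a b x :: int
  assumes "a ^ n dvd x" "b ^ n dvd x"
  shows "lcm a b ^ n dvd x"
proof (cases "a = 0 \<or> b = 0")
  case False
  then obtain a' b' where ab: "a = a' * gcd a b" "b = b' * gcd a b" "coprime a' b'"
    using gcd_coprime_exists[of a b] by auto
  define g where "g = gcd a b"
  have a: "a = a' * g" and b: "b = b' * g" using ab by (simp_all add: g_def)
  have g: "g \<noteq> 0" using False by (simp add: g_def)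
  obtain y where y: "x = a ^ n * y" using assms(1) by auto
  have "b' ^ n * g ^ n dvd (a' ^ n * y) * g ^ n"
    using assms(2) unfolding y unfolding a b by (simp add: power_mult_distrib mult.assoc mult.commute mult.left_commute)
  then have "b' ^ n dvd a' ^ n * y" using g by simp
  then have "b' ^ n dvd y" using ab(3) by (simp add: coprime_dvd_mult_right_iff coprime_commute)
  then have "(a * b') ^ n dvd x" by (simp add: y power_mult_distrib)
  moreover have "lcm a b dvd a * b'" by (rule lcm_least) (simp_all add: a b)
  ultimately show ?thesis using dvd_power_same dvd_trans by blast
qed (use assms in auto)

lemma weighted_dvd_lcm:
  assumes "weighted_dvd w a P" "weighted_dvd w b P"
  shows "weighted_dvd w (lcm a b) P"
  using assms lcm_power_dvd[of "int a" _ _ "int b"] by (simp add: weighted_dvd_def)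

lemma weighted_dvd_mono: "k dvd m \<Longrightarrow> weighted_dvd w m P \<Longrightarrow> weighted_dvd w k P"
  unfolding weighted_dvd_def by (meson dvd_power_same dvd_trans of_nat_dvd_iff)

lemma weighted_dvd_Lcm:
  "finite D \<Longrightarrow> (\<And>k. k \<in> D \<Longrightarrow> weighted_dvd w k P) \<Longrightarrow> weighted_dvd w (Lcm D) P"
  by (induction D rule: finite_induct) (auto simp: weighted_dvd_lcm weighted_dvd_def[of w 1] simp flip: One_nat_def)

lemma weighted_dvd_le:
  assumes "w i > 0" "P $ i > 0" "weighted_dvd w k P"
  shows "0 < k" "int k \<le> P $ i"
proof -
  have d: "int (k ^ w i) dvd P $ i" using assms by (simp add: weighted_dvd_def)
  then show k: "0 < k" using assms by (cases "k = 0") (auto simp: zero_power)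
  have "int k \<le> int (k ^ w i)" using k assms self_le_power[of k "w i"] by (simp del: of_nat_power)
  also have "\<dots> \<le> P $ i" using d assms by (simp add: zdvd_imp_le)
  finally show "int k \<le> P $ i" .
qed

text \<open>The set of possible \<open>k\<close> is bounded by any coordinate of \<open>P\<close>, closed under least common multiples
  and under taking divisors; so it consists of the divisors of its own least common multiple. This
  is what makes Moebius inversion over these \<open>k\<close> the classical one over the divisors of an integer.\<close>
lemma weighted_divisors_are_divisors:
  fixes w :: "'n::finite \<Rightarrow> nat"
  assumes "\<And>i. w i > 0" "\<And>i. P $ i > 0"
  obtains K where "K > 0" "\<And>k. weighted_dvd w k P \<longleftrightarrow> k dvd K"
proof
  define D where "D = {k. weighted_dvd w k P}"
  have "D \<subseteq> {..nat (P $ undefined)}"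
    using weighted_dvd_le(2)[where w = w and P = P and i = undefined, OF assms] nat_mono
    unfolding D_def by fastforce
  then have fin: "finite D" by (rule finite_subset) simp
  have "0 \<notin> D" using weighted_dvd_le(1)[where w = w and P = P, OF assms] unfolding D_def by blast
  then show "Lcm D > 0" using fin by (metis Lcm_0_iff gr0I)
  show "weighted_dvd w k P \<longleftrightarrow> k dvd Lcm D" for k
    using weighted_dvd_Lcm[OF fin] weighted_dvd_mono[of k "Lcm D"] by (auto simp: D_def)
qed

section \<open>Visibility as weighted divisibility\<close>

text \<open>The exponents \<open>m\<close> for which \<open>x ^ m\<close> is rational are closed under greatest common divisors, by
  Bezout's identity: if \<open>m * u = n * v + gcd m n\<close>, divide \<open>(x ^ m) ^ u\<close> by \<open>(x ^ n) ^ v\<close>.\<close>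
lemma rational_power_Gcd:
  fixes x :: real
  assumes "x \<noteq> 0" "finite A" "\<And>m. m \<in> A \<Longrightarrow> x ^ m \<in> \<rat>"
  shows "x ^ Gcd A \<in> \<rat>"
  using assms(2,3)
proof (induction A rule: finite_induct)
  case (insert m A)
  show ?case
  proof (cases "m = 0")
    case False
    then obtain u v where uv: "m * u = Gcd A * v + gcd m (Gcd A)"
      using bezout_nat by blast
    have "x ^ m \<in> \<rat>" "x ^ Gcd A \<in> \<rat>" using insert by auto
    then have "(x ^ m) ^ u / (x ^ Gcd A) ^ v \<in> \<rat>" by (metis Rats_divide Rats_power)
    also have "(x ^ m) ^ u / (x ^ Gcd A) ^ v = x ^ gcd m (Gcd A)"
      using \<open>x \<noteq> 0\<close> by (simp add: uv power_add flip: power_mult)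
    finally show ?thesis by simp
  qed (use insert in auto)
qed simp

lemma monomial_branch_eq_iff:
  "monomial_branch w a \<alpha> t = real_vec P \<longleftrightarrow> (\<forall>i. of_rat (a i \<alpha>) * t ^ w i = real_of_int (P $ i))"
  by (simp add: monomial_branch_def real_vec_def vec_eq_iff)

lemma monomial_branch_descend:
  assumes "monomial_branch w a \<alpha> t = real_vec P" "weighted_dvd w k P" "k > 0"
  shows "monomial_branch w a \<alpha> (t / real k) = real_vec (\<chi> i. P $ i div int (k ^ w i))"
  using assms unfolding monomial_branch_eq_iff weighted_dvd_def
  by (simp add: real_of_int_div power_divide flip: of_nat_power)

text \<open>Two integral points on a branch differ by a \<^emph>\<open>rational\<close> scaling factor. All the powers
  \<open>(t / s) ^ w i = P $ i / Q $ i\<close> are rational and the weights have greatest common divisor 1, so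
  \<open>t / s\<close> itself is a reduced fraction \<open>c / d\<close>. Clearing denominators gives the displayed
  equation, and since \<open>c\<close> and \<open>d\<close> are coprime, \<open>c ^ w i\<close> must divide \<open>P $ i\<close>.\<close>
lemma monomial_branch_ratio:
  fixes w :: "'n::finite \<Rightarrow> nat"
  assumes P: "monomial_branch w a \<alpha> t = real_vec P" and Q: "monomial_branch w a \<alpha> s = real_vec Q"
    and st: "0 < s" "s < t" and a: "\<And>i. a i \<alpha> > 0" and w: "Gcd (range w) = 1"
  obtains c d :: nat where "coprime c d" "0 < d" "d < c" "weighted_dvd w c P"
    "\<And>i. P $ i * int (d ^ w i) = Q $ i * int (c ^ w i)"
proof -
  have ra: "(of_rat (a i \<alpha>) :: real) > 0" for i using a by simp
  have ratio: "(t / s) ^ w i = real_of_int (P $ i) / real_of_int (Q $ i)" for i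
  proof -
    have "real_of_int (P $ i) = of_rat (a i \<alpha>) * t ^ w i" "real_of_int (Q $ i) = of_rat (a i \<alpha>) * s ^ w i"
      using P Q unfolding monomial_branch_eq_iff by simp_all
    then show ?thesis using ra[of i] by (simp add: power_divide)
  qed
  \<comment> \<open>For weights with a common factor \<open>g\<close>, the argument would only make \<open>(t / s) ^ g\<close> rational.\<close>
  have "(t / s) ^ Gcd (range w) \<in> \<rat>"
    by (rule rational_power_Gcd) (use st ratio in auto)
  then have "t / s \<in> \<rat>" by (simp add: w)
  then obtain c d :: nat where cd: "d \<noteq> 0" "\<bar>t / s\<bar> = real c / real d" "coprime c d"
    by (rule Rats_abs_nat_div_natE)
  have cd': "t / s = real c / real d" using cd(2) st by simp
  show thesis
  proof
    show "coprime c d" by fact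
    show "0 < d" using cd by simp
    have "1 < real c / real d" using st by (simp flip: cd')
    then show "d < c" using cd by (simp add: field_simps)
    show eq: "P $ i * int (d ^ w i) = Q $ i * int (c ^ w i)" for i
    proof -
      have "real_of_int (P $ i) * real d ^ w i = of_rat (a i \<alpha>) * (t * real d) ^ w i"
        using P unfolding monomial_branch_eq_iff by (simp add: power_mult_distrib flip: P)
      also have "t * real d = s * real c" using cd' cd st by (simp add: field_simps)
      also have "of_rat (a i \<alpha>) * (s * real c) ^ w i = real_of_int (Q $ i) * real c ^ w i"
        using Q unfolding monomial_branch_eq_iff by (simp add: power_mult_distrib flip: Q)
      finally have "real_of_int (P $ i * int (d ^ w i)) = real_of_int (Q $ i * int (c ^ w i))" by simp
      then show ?thesis by (simp only: of_int_eq_iff)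
    qed
    have "int (c ^ w i) dvd P $ i" for i
    proof -
      have "int (c ^ w i) dvd P $ i * int (d ^ w i)" unfolding eq by (rule dvd_triv_right)
      moreover have "coprime (int (c ^ w i)) (int (d ^ w i))" using cd(3) by simp
      ultimately show ?thesis using coprime_dvd_mult_left_iff by blast
    qed
    then show "weighted_dvd w c P" by (simp add: weighted_dvd_def)
  qed
qed

text \<open>An integral point closer to the base point has parameter \<open>t * d / c\<close> with \<open>d < c\<close>, and then \<open>P\<close> is
  already divisible by \<open>c \<ge> 2\<close> in the weighted sense; so when looking for blocking points it suffices to
  try the parameters \<open>t / k\<close> with \<open>k\<close> an integer.\<close>
lemma globally_visible_eq:
  fixes w :: "'n::finite \<Rightarrow> nat"
  assumes w: "Gcd (range w) = 1" and a: "\<And>i \<alpha>. \<alpha> \<in> I \<Longrightarrow> a i \<alpha> > 0"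
  shows "globally_visible I (monomial_branch w a) =
    {P \<in> branch_locus I (monomial_branch w a). \<forall>k\<ge>2. \<not> weighted_dvd w k P}" (is "?L = ?R")
proof (intro equalityI subsetI)
  fix P assume "P \<in> ?L"
  then obtain \<alpha> t where P: "\<alpha> \<in> I" "t > 0" "monomial_branch w a \<alpha> t = real_vec P"
    and vis: "\<And>s Q. 0 < s \<Longrightarrow> s < t \<Longrightarrow> monomial_branch w a \<alpha> s \<noteq> real_vec Q"
    unfolding globally_visible_def by blast
  have "\<not> weighted_dvd w k P" if "k \<ge> 2" for k
    using monomial_branch_descend[OF P(3), of k] vis[of "t / real k"] P(2) that
    by (auto simp: field_simps)
  then show "P \<in> ?R" using P unfolding branch_locus_def by blast
next
  fix P assume "P \<in> ?R"
  then obtain \<alpha> t where P: "\<alpha> \<in> I" "t > 0" "monomial_branch w a \<alpha> t = real_vec P"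
    and prim: "\<And>k. k \<ge> 2 \<Longrightarrow> \<not> weighted_dvd w k P"
    unfolding branch_locus_def by blast
  have False if Q: "0 < s" "s < t" "monomial_branch w a \<alpha> s = real_vec Q" for s Q
  proof -
    obtain c d where cd: "coprime c d" "0 < d" "d < c" "weighted_dvd w c P"
      and eq: "\<And>i. P $ i * int (d ^ w i) = Q $ i * int (c ^ w i)"
      using monomial_branch_ratio[OF P(3) Q(3,1,2) a[OF P(1)] w] by metis
    show False using cd prim[of c] by simp
  qed
  then show "P \<in> ?L" using P unfolding globally_visible_def by blast
qed

lemma point_val_le_iff:
  "point_val p P \<le> point_val p Q \<longleftrightarrow> (\<forall>j. \<exists>i. int_val p (P $ i) \<le> int_val p (Q $ j))"
  unfolding point_val_def by (subst Min_ge_iff) (auto simp: Min_le_iff)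

lemma int_val_mono:
  assumes "prime p" "\<And>n. int p ^ n dvd x \<Longrightarrow> int p ^ n dvd y" "x \<noteq> 0"
  shows "int_val p x \<le> int_val p y"
proof (cases "y = 0")
  case False
  have "int p ^ multiplicity (int p) x dvd y" using assms(2) multiplicity_dvd by blast
  then have "multiplicity (int p) x \<le> multiplicity (int p) y"
    using False assms(1) by (intro multiplicity_geI) auto
  then show ?thesis using False assms(3) by (simp add: int_val_def)
qed (simp add: int_val_def)

text \<open>If \<open>P\<close> can be scaled down by \<open>p\<close>, the resulting point is earlier on the branch and has strictly
  smaller valuation, as all weights are positive. Conversely, an earlier point \<open>Q\<close> arises from \<open>P\<close> by
  a reduced fraction \<open>d / c\<close>; a drop of the valuation needs a factor \<open>p\<close> in \<open>c\<close>, and \<open>P\<close> is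
  divisible by \<open>c\<close>, hence by \<open>p\<close>, in the weighted sense.\<close>
lemma padically_visible_eq:
  fixes w :: "'n::finite \<Rightarrow> nat"
  assumes w0: "\<And>i. w i > 0" and w: "Gcd (range w) = 1" and a: "\<And>i \<alpha>. \<alpha> \<in> I \<Longrightarrow> a i \<alpha> > 0"
    and p: "prime p"
  shows "padically_visible p I (monomial_branch w a) =
    {P \<in> branch_locus I (monomial_branch w a). \<not> weighted_dvd w p P}" (is "?L = ?R")
proof (intro equalityI subsetI)
  fix P assume "P \<in> ?L"
  then obtain \<alpha> t where P: "\<alpha> \<in> I" "t > 0" "monomial_branch w a \<alpha> t = real_vec P"
    and vis: "\<And>s Q. 0 < s \<Longrightarrow> s < t \<Longrightarrow> monomial_branch w a \<alpha> s = real_vec Q \<Longrightarrow> point_val p P \<le> point_val p Q"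
    unfolding padically_visible_def by blast
  have "\<not> weighted_dvd w p P"
  proof
    assume wd: "weighted_dvd w p P"
    define Q where "Q = (\<chi> i. P $ i div int (p ^ w i))"
    have p1: "p > 1" using p prime_gt_1_nat by blast
    have "point_val p P \<le> point_val p Q"
      by (rule vis[of "t / real p"])
         (use P p1 monomial_branch_descend[OF P(3) wd] in \<open>auto simp: Q_def field_simps\<close>)
    \<comment> \<open>A coordinate attaining the minimum at \<open>P\<close> loses \<open>w j\<close> factors \<open>p\<close> on the way to \<open>Q\<close>.\<close>
    moreover have "point_val p P \<in> range (\<lambda>i. int_val p (P $ i))"
      unfolding point_val_def by (rule Min_in) auto
    then obtain j where j: "point_val p P = int_val p (P $ j)" by blast
    moreover have "point_val p Q \<le> int_val p (Q $ j)" unfolding point_val_def by (rule Min_le) auto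
    ultimately have "int_val p (P $ j) \<le> int_val p (Q $ j)" by simp
    moreover have PQ: "P $ j = int p ^ w j * Q $ j"
      using wd by (simp add: Q_def weighted_dvd_def)
    moreover have "P $ j \<noteq> 0"
      using P(2,3) a[OF P(1), of j] unfolding monomial_branch_eq_iff
      by (metis less_numeral_extra(3) mult_eq_0_iff of_int_0 power_not_zero zero_less_of_rat_iff)
    moreover have "multiplicity (int p) (P $ j) = w j + multiplicity (int p) (Q $ j)"
      using p \<open>P $ j \<noteq> 0\<close> unfolding PQ by (subst prime_elem_multiplicity_mult_distrib) auto
    ultimately show False using w0[of j] by (auto simp: int_val_def)
  qed
  then show "P \<in> ?R" using P unfolding branch_locus_def by blast
next
  fix P assume "P \<in> ?R"
  then obtain \<alpha> t where P: "\<alpha> \<in> I" "t > 0" "monomial_branch w a \<alpha> t = real_vec P"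
    and prim: "\<not> weighted_dvd w p P"
    unfolding branch_locus_def by blast
  have "point_val p P \<le> point_val p Q" if Q: "0 < s" "s < t" "monomial_branch w a \<alpha> s = real_vec Q" for s Q
  proof -
    obtain c d where cd: "coprime c d" "0 < d" "d < c" "weighted_dvd w c P"
      and eq: "\<And>i. P $ i * int (d ^ w i) = Q $ i * int (c ^ w i)"
      using monomial_branch_ratio[OF P(3) Q(3,1,2) a[OF P(1)] w] by metis
    \<comment> \<open>If \<open>p\<close> divided \<open>c\<close>, then \<open>P\<close> could be scaled down by \<open>p\<close>; so passing from \<open>P\<close> to \<open>Q\<close> can
      only gain factors \<open>p\<close>, those of the denominator \<open>d\<close>.\<close>
    have "\<not> p dvd c" using cd(4) prim weighted_dvd_mono by blast
    then have cop: "coprime (int p) (int c)" using p prime_imp_coprime by auto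
    have "int_val p (P $ i) \<le> int_val p (Q $ i)" for i
    proof (rule int_val_mono[OF p])
      show "P $ i \<noteq> 0"
        using P(2,3) a[OF P(1), of i] unfolding monomial_branch_eq_iff
        by (metis less_numeral_extra(3) mult_eq_0_iff of_int_0 power_not_zero zero_less_of_rat_iff)
      fix n assume "int p ^ n dvd P $ i"
      then have "int p ^ n dvd Q $ i * int (c ^ w i)" unfolding eq[symmetric] by simp
      then show "int p ^ n dvd Q $ i" using cop by (simp add: coprime_dvd_mult_left_iff)
    qed
    then show ?thesis unfolding point_val_le_iff by blast
  qed
  then show "P \<in> ?L" using P unfolding padically_visible_def by blast
qed

section \<open>Counting weighted multiples in boxes\<close>

lemma card_vec_box:
  fixes A :: "'n::finite \<Rightarrow> 'a set"
  shows "card {P :: 'a ^ 'n. \<forall>i. P $ i \<in> A i} = (\<Prod>i\<in>UNIV. card (A i))"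
proof -
  have "bij_betw vec_lambda (PiE UNIV A) {P :: 'a ^ 'n. \<forall>i. P $ i \<in> A i}"
    by (rule bij_betwI[of _ _ _ vec_nth]) (auto simp: PiE_def)
  then show ?thesis by (simp add: card_PiE flip: bij_betw_same_card)
qed

lemma card_multiples_upto:
  assumes "m > 0"
  shows "card {x \<in> {1..int N}. int m dvd x} = N div m"
proof -
  have "bij_betw (\<lambda>j. int (m * j)) {1..N div m} {x \<in> {1..int N}. int m dvd x}"
  proof (rule bij_betwI[of _ _ _ "\<lambda>x. nat x div m"])
    show "(\<lambda>j. int (m * j)) \<in> {1..N div m} \<rightarrow> {x \<in> {1..int N}. int m dvd x}"
    proof safe
      fix j assume "j \<in> {1..N div m}"
      then have "1 \<le> j" "j * m \<le> N" using assms by (auto simp: less_eq_div_iff_mult_less_eq)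
      then have "1 * 1 \<le> m * j" "m * j \<le> N" using assms by (intro mult_mono, auto simp: mult.commute)
      then show "int (m * j) \<in> {1..int N}" unfolding atLeastAtMost_iff by linarith
    qed auto
    show "(\<lambda>x. nat x div m) \<in> {x \<in> {1..int N}. int m dvd x} \<rightarrow> {1..N div m}"
    proof (rule Pi_I)
      fix x assume x: "x \<in> {x \<in> {1..int N}. int m dvd x}"
      then obtain j where j: "nat x = m * j"
        by (metis (mono_tags, lifting) dvdE mem_Collect_eq nat_int nat_mult_distrib of_nat_0_le_iff)
      have "0 < nat x" "nat x \<le> N" using x by auto
      then have "0 < m * j" "m * j \<le> N" unfolding j .
      then show "nat x div m \<in> {1..N div m}"
        using assms j by (auto simp: less_eq_div_iff_mult_less_eq mult.commute)
    qed
    show "int (m * (nat x div m)) = x" if "x \<in> {x \<in> {1..int N}. int m dvd x}" for x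
      using that by (auto simp: zdiv_int)
    show "nat (int (m * j)) div m = j" for j using assms by (simp only: nat_int) simp
  qed
  from bij_betw_same_card[OF this] show ?thesis by simp
qed

definition positive_box :: "nat \<Rightarrow> (int ^ 'n::finite) set" where
  "positive_box N = {P. \<forall>i. P $ i \<in> {1..int N}}"

lemma card_positive_box: "card (positive_box N :: (int ^ 'n::finite) set) = N ^ CARD('n)"
  unfolding positive_box_def card_vec_box by simp

lemma finite_positive_box: "finite (positive_box N :: (int ^ 'n::finite) set)"
proof (cases "N = 0")
  case False
  then show ?thesis by (intro card_ge_0_finite) (simp add: card_positive_box)
qed (simp add: positive_box_def)

text \<open>The coordinates of a weighted multiple of \<open>k\<close> vary independently, so the count is a product.\<close>
lemma card_weighted_multiples:
  fixes w :: "'n::finite \<Rightarrow> nat"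
  assumes "k > 0"
  shows "card {P \<in> positive_box N. weighted_dvd w k P} = (\<Prod>i\<in>UNIV. N div k ^ w i)"
proof -
  have "{P \<in> positive_box N. weighted_dvd w k P} = {P. \<forall>i. P $ i \<in> {x \<in> {1..int N}. int (k ^ w i) dvd x}}"
    by (auto simp: positive_box_def weighted_dvd_def)
  then show ?thesis
    using assms by (simp only: card_vec_box) (simp add: card_multiples_upto del: of_nat_power atLeastAtMost_iff)
qed

lemma sum_if_eq_card:
  "finite A \<Longrightarrow> (\<Sum>x\<in>A. if Q x then c else 0) = c * real (card {x \<in> A. Q x})"
  by (simp flip: sum.inter_filter)

text \<open>Moebius inversion. The \<open>k\<close> that divide a given \<open>P\<close> in the weighted sense are the divisors of one
  integer \<open>K\<close>, so the sum of the Moebius function over them is 1 exactly for the points that are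
  counted on the right; it remains to exchange the two summations. For \<open>k > N\<close> the box contains no
  multiples, whence the series is a finite sum.\<close>
lemma card_weighted_primitive:
  fixes w :: "'n::finite \<Rightarrow> nat"
  assumes w: "\<And>i. w i > 0"
  shows "(\<lambda>k. moebius_mu (Suc k) * real (card {P \<in> positive_box N. weighted_dvd w (Suc k) P})) sums
    real (card {P \<in> positive_box N. \<forall>k\<ge>2. \<not> weighted_dvd w k P})"
proof -
  have moeb: "(\<Sum>k\<in>{1..N}. if weighted_dvd w k P then moebius_mu k else 0) =
      (if \<forall>k\<ge>2. \<not> weighted_dvd w k P then 1 else 0)" if P: "P \<in> positive_box N" for P
  proof -
    have pos: "P $ i > 0" for i using P by (auto simp: positive_box_def int_one_le_iff_zero_less)
    obtain K where K: "K > 0" "\<And>k. weighted_dvd w k P \<longleftrightarrow> k dvd K"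
      by (rule weighted_divisors_are_divisors[where w = w and P = P, OF w pos]) (rule that)
    \<comment> \<open>Any coordinate bounds \<open>K\<close>, so \<open>undefined\<close> serves as an arbitrary index.\<close>
    have "int K \<le> P $ undefined"
      by (rule weighted_dvd_le(2)[where w = w, OF w pos]) (simp add: K(2))
    also have "P $ undefined \<le> int N" using P by (simp add: positive_box_def)
    finally have "K \<le> N" by simp
    have sub: "{d. d dvd K} \<subseteq> {1..N}"
    proof
      fix d assume "d \<in> {d. d dvd K}"
      then have "d dvd K" by simp
      then have "0 < d" "d \<le> K" using K(1) by (auto intro: dvd_pos_nat dvd_imp_le)
      then show "d \<in> {1..N}" using \<open>K \<le> N\<close> by simp
    qed
    have "(\<Sum>k\<in>{1..N}. if weighted_dvd w k P then moebius_mu k else 0) = (\<Sum>d | d dvd K. moebius_mu d)"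
      unfolding K(2) by (intro sum.mono_neutral_cong_right sub) auto
    also have "\<dots> = (if K = 1 then 1 else 0)" using K(1) by (rule sum_moebius_divisors)
    also have "K = 1 \<longleftrightarrow> (\<forall>k\<ge>2. \<not> weighted_dvd w k P)"
    proof (cases "K = 1")
      case False
      with K(1) have "K \<ge> 2" by linarith
      then show ?thesis using False K(2)[of K] by (metis dvd_refl)
    next
      case True
      show ?thesis unfolding K(2) True by simp
    qed
    finally show ?thesis .
  qed
  have "real (card {P \<in> positive_box N. \<forall>k\<ge>2. \<not> weighted_dvd w k P}) =
      (\<Sum>P\<in>positive_box N. if \<forall>k\<ge>2. \<not> weighted_dvd w k P then 1 else 0)"
    by (subst sum_if_eq_card) (simp_all add: finite_positive_box)
  also have "\<dots> = (\<Sum>P\<in>positive_box N. \<Sum>k\<in>{1..N}. if weighted_dvd w k P then moebius_mu k else 0)"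
    by (intro sum.cong refl moeb[symmetric])
  also have "\<dots> = (\<Sum>k\<in>{1..N}. \<Sum>P\<in>positive_box N. if weighted_dvd w k P then moebius_mu k else 0)"
    by (rule sum.swap)
  also have "\<dots> = (\<Sum>k\<in>{1..N}. moebius_mu k * real (card {P \<in> positive_box N. weighted_dvd w k P}))"
    by (intro sum.cong refl sum_if_eq_card finite_positive_box)
  also have "\<dots> = (\<Sum>k<N. moebius_mu (Suc k) * real (card {P \<in> positive_box N. weighted_dvd w (Suc k) P}))"
    by (simp add: sum.atLeast1_atMost_eq)
  finally have eq: "real (card {P \<in> positive_box N. \<forall>k\<ge>2. \<not> weighted_dvd w k P}) =
    (\<Sum>k<N. moebius_mu (Suc k) * real (card {P \<in> positive_box N. weighted_dvd w (Suc k) P}))" .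
  show ?thesis unfolding eq
  proof (rule sums_finite)
    fix k assume "k \<notin> {..<N}"
    moreover have "Suc k \<le> Suc k ^ w undefined" using w[of undefined] by (intro self_le_power) auto
    ultimately have "N div Suc k ^ w undefined = 0" by (intro div_less) auto
    then have "(\<Prod>i\<in>UNIV. N div Suc k ^ w i) = 0" by (intro prod_zero) auto
    then show "moebius_mu (Suc k) * real (card {P \<in> positive_box N. weighted_dvd w (Suc k) P}) = 0"
      by (simp add: card_weighted_multiples del: power_Suc)
  qed simp
qed

section \<open>Densities along boxes\<close>

lemma div_over_tendsto:
  assumes "m > 0"
  shows "(\<lambda>N. real (N div m) / real N) \<longlonglongrightarrow> 1 / real m"
proof (rule tendsto_sandwich)
  show "eventually (\<lambda>N. 1 / real m - 1 / real N \<le> real (N div m) / real N) sequentially"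
    using eventually_gt_at_top[of 0]
  proof eventually_elim
    case (elim N)
    have "N \<le> m * (N div m) + m"
      using mult_div_mod_eq[of m N] mod_less_divisor[OF assms, of N] by linarith
    then have "real N \<le> real m * real (N div m) + real m" by (simp flip: of_nat_mult of_nat_add)
    then have "real N / real m - 1 \<le> real (N div m)" using assms by (simp add: field_simps)
    then have "(real N / real m - 1) / real N \<le> real (N div m) / real N" by (rule divide_right_mono) simp
    then show ?case using elim by (simp add: diff_divide_distrib)
  qed
  show "eventually (\<lambda>N. real (N div m) / real N \<le> 1 / real m) sequentially"
    using eventually_gt_at_top[of 0]
  proof eventually_elim
    case (elim N)
    have "real (N div m) \<le> real N / real m" by (rule of_nat_div_le_of_nat)
    then show ?case using elim assms by (simp add: field_simps)
  qed
  show "(\<lambda>N. 1 / real m - 1 / real N) \<longlonglongrightarrow> 1 / real m"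
    using tendsto_diff[OF tendsto_const lim_1_over_n] by simp
qed simp

lemma density_weighted_multiples:
  fixes w :: "'n::finite \<Rightarrow> nat"
  assumes "k > 0"
  shows "(\<lambda>N. real (card {P \<in> positive_box N. weighted_dvd w k P}) / real N ^ CARD('n))
    \<longlonglongrightarrow> 1 / real k ^ (\<Sum>i\<in>UNIV. w i)"
proof -
  have "(\<lambda>N. \<Prod>i\<in>UNIV. real (N div k ^ w i) / real N) \<longlonglongrightarrow> (\<Prod>i\<in>UNIV. 1 / real (k ^ w i))"
    by (intro tendsto_prod div_over_tendsto) (use assms in auto)
  moreover have "(\<Prod>i\<in>UNIV. 1 / real (k ^ w i)) = 1 / real k ^ (\<Sum>i\<in>UNIV. w i)"
    by (simp add: power_sum prod_dividef)
  ultimately show ?thesis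
    using assms by (simp add: card_weighted_multiples prod_dividef)
qed

text \<open>The limit in the preceding lemma is also an upper bound for every \<open>N\<close>. This uniformity in \<open>N\<close> is
  what allows passing to the limit under the infinite sum over \<open>k\<close>. At \<open>N = 0\<close> the quotient is 0.\<close>
lemma density_weighted_multiples_le:
  fixes w :: "'n::finite \<Rightarrow> nat"
  assumes "k > 0"
  shows "real (card {P \<in> positive_box N. weighted_dvd w k P}) / real N ^ CARD('n) \<le> 1 / real k ^ (\<Sum>i\<in>UNIV. w i)"
proof -
  have "(\<Prod>i\<in>UNIV. real (N div k ^ w i) / real N) \<le> (\<Prod>i\<in>UNIV. 1 / real (k ^ w i))"
  proof (intro prod_mono conjI)
    fix i
    show "real (N div k ^ w i) / real N \<le> 1 / real (k ^ w i)"
      using of_nat_div_le_of_nat[of N "k ^ w i", where 'a = real] assms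
      by (cases "N = 0") (auto simp: field_simps)
  qed simp
  then show ?thesis
    using assms by (simp add: card_weighted_multiples prod_dividef power_sum)
qed

lemma density_not_weighted_multiples:
  fixes w :: "'n::finite \<Rightarrow> nat"
  assumes "k > 0"
  shows "(\<lambda>N. real (card {P \<in> positive_box N. \<not> weighted_dvd w k P}) / real N ^ CARD('n))
    \<longlonglongrightarrow> 1 - 1 / real k ^ (\<Sum>i\<in>UNIV. w i)"
proof (rule Lim_transform_eventually)
  show "(\<lambda>N. 1 - real (card {P \<in> positive_box N. weighted_dvd w k P}) / real N ^ CARD('n))
    \<longlonglongrightarrow> 1 - 1 / real k ^ (\<Sum>i\<in>UNIV. w i)"
    by (intro tendsto_diff tendsto_const density_weighted_multiples assms)
  show "eventually (\<lambda>N. 1 - real (card {P \<in> positive_box N. weighted_dvd w k P}) / real N ^ CARD('n) =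
      real (card {P \<in> positive_box N. \<not> weighted_dvd w k P}) / real N ^ CARD('n)) sequentially"
    using eventually_gt_at_top[of 0]
  proof eventually_elim
    case (elim N)
    have "card (positive_box N :: (int ^ 'n) set) =
        card {P \<in> positive_box N. weighted_dvd w k P} + card {P \<in> positive_box N. \<not> weighted_dvd w k P}"
      using finite_positive_box[where N = N and 'n = 'n] by (subst card_Un_disjoint[symmetric]) (auto intro: arg_cong[where f = card])
    then have "real N ^ CARD('n) = real (card {P \<in> positive_box N. weighted_dvd w k P}) + real (card {P \<in> positive_box N. \<not> weighted_dvd w k P})"
      unfolding card_positive_box by (simp flip: of_nat_power of_nat_add)
    moreover have "real N ^ CARD('n) \<noteq> 0" using elim by simp
    ultimately show ?case by (simp add: divide_eq_eq eq_divide_eq left_diff_distrib)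
  qed
qed

text \<open>Tannery's theorem applied to the Moebius sum (\<open>card_weighted_primitive\<close>) divided by \<open>N ^ CARD('n)\<close>: its
  \<open>k\<close>-th term tends to \<open>\<mu>(k) / k ^ W\<close> and is dominated by \<open>1 / k ^ W\<close>, which is summable because \<open>W \<ge> 2\<close>. The
  limit is the reciprocal of the zeta value.\<close>
lemma density_weighted_primitive:
  fixes w :: "'n::finite \<Rightarrow> nat"
  assumes w: "\<And>i. w i > 0" and W: "(\<Sum>i\<in>UNIV. w i) \<ge> 2"
  shows "(\<lambda>N. real (card {P \<in> positive_box N. \<forall>k\<ge>2. \<not> weighted_dvd w k P}) / real N ^ CARD('n))
    \<longlonglongrightarrow> 1 / riemann_zeta (real (\<Sum>i\<in>UNIV. w i))"
proof -
  define W where "W = (\<Sum>i\<in>UNIV. w i)"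
  define f where "f k N = moebius_mu (Suc k) * (real (card {P \<in> positive_box N. weighted_dvd w (Suc k) P}) / real N ^ CARD('n))" for k N
  define b where "b k = 1 / real (Suc k) ^ W" for k
  have W2: "W \<ge> 2" using W by (simp add: W_def)
  have lim: "(\<lambda>N. f k N) \<longlonglongrightarrow> moebius_mu (Suc k) * b k" for k
    unfolding f_def b_def W_def by (intro tendsto_mult_left density_weighted_multiples) simp
  have bound: "norm (f k N) \<le> b k" for k N
  proof -
    have "norm (f k N) = \<bar>moebius_mu (Suc k)\<bar> * (real (card {P \<in> positive_box N. weighted_dvd w (Suc k) P}) / real N ^ CARD('n))"
      by (simp add: f_def abs_mult)
    also have "\<dots> \<le> 1 * (1 / real (Suc k) ^ W)"
      unfolding W_def by (intro mult_mono abs_moebius_le_1 density_weighted_multiples_le) auto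
    finally show ?thesis by (simp add: b_def)
  qed
  have "summable b"
    unfolding b_def using inverse_power_summable[OF W2, where 'a = real]
    by (subst summable_Suc_iff) (simp add: inverse_eq_divide)
  then have "(\<lambda>N. \<Sum>k. f k N) \<longlonglongrightarrow> (\<Sum>k. moebius_mu (Suc k) * b k)"
    using tannerys_theorem[of f _ sequentially b, OF lim] bound by (simp add: case_prod_unfold)
  moreover have "(\<Sum>k. f k N) = real (card {P \<in> positive_box N. \<forall>k\<ge>2. \<not> weighted_dvd w k P}) / real N ^ CARD('n)" for N
    using sums_divide[OF card_weighted_primitive[where w = w, OF w], of N "real N ^ CARD('n)"]
    unfolding f_def by (simp add: sums_iff)
  moreover have "(\<Sum>k. moebius_mu (Suc k) * b k) = 1 / riemann_zeta (real W)"
  proof -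
    have "riemann_zeta (real W) = (\<Sum>k. 1 / real (Suc k) ^ W)"
      unfolding riemann_zeta_def by (simp add: powr_realpow del: of_nat_Suc)
    moreover have "(\<Sum>k. moebius_mu (Suc k) * b k) * (\<Sum>k. 1 / real (Suc k) ^ W) = 1"
      using moebius_times_zeta[OF W2] by (simp add: b_def)
    ultimately show ?thesis by (metis eq_divide_imp mult_zero_right zero_neq_one)
  qed
  ultimately show ?thesis by (simp add: W_def)
qed

section \<open>Relative densities of the visible points\<close>

text \<open>Once the branch locus is the set of all positive integral points, its points of height at most
  \<open>X\<close> form the box with side \<open>\<lfloor>X\<rfloor>\<close>, so relative densities are limits along boxes.\<close>
lemma has_relative_density_of_boxes:
  fixes \<phi> :: "'i \<Rightarrow> real \<Rightarrow> real ^ 'n::finite"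
  assumes locus: "branch_locus I \<phi> = {P. \<forall>i. P $ i \<ge> 1}"
    and lim: "(\<lambda>N. real (card (S \<inter> positive_box N)) / real N ^ CARD('n)) \<longlonglongrightarrow> d"
  shows "has_relative_density I \<phi> S d"
proof -
  have "filterlim (\<lambda>X::real. nat \<lfloor>X\<rfloor>) sequentially at_top"
    by (intro filterlim_compose[OF filterlim_nat_sequentially filterlim_floor_sequentially])
  then have "((\<lambda>X::real. real (card (S \<inter> positive_box (nat \<lfloor>X\<rfloor>))) / real (nat \<lfloor>X\<rfloor>) ^ CARD('n)) \<longlongrightarrow> d) at_top"
    by (rule filterlim_compose[OF lim])
  moreover
  have "branch_locus_upto I \<phi> X = positive_box (nat \<lfloor>X\<rfloor>)" if "X \<ge> 0" for X :: real
  proof -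
    have "real_of_int (height P) \<le> X \<longleftrightarrow> (\<forall>i. \<bar>P $ i\<bar> \<le> int (nat \<lfloor>X\<rfloor>))" for P :: "int ^ 'n"
    proof -
      have "real_of_int (height P) \<le> X \<longleftrightarrow> height P \<le> int (nat \<lfloor>X\<rfloor>)"
        using that by (simp add: le_floor_iff)
      also have "\<dots> \<longleftrightarrow> (\<forall>i. \<bar>P $ i\<bar> \<le> int (nat \<lfloor>X\<rfloor>))"
        unfolding height_def by (subst Max_le_iff) auto
      finally show ?thesis .
    qed
    moreover have "1 \<le> x \<and> \<bar>x\<bar> \<le> m \<longleftrightarrow> 1 \<le> x \<and> x \<le> m" for x m :: int by auto
    ultimately show ?thesis
      by (simp add: branch_locus_upto_def locus positive_box_def flip: all_conj_distrib)
  qed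
  then have "eventually (\<lambda>X. real (card (S \<inter> positive_box (nat \<lfloor>X\<rfloor>))) / real (nat \<lfloor>X\<rfloor>) ^ CARD('n) =
      real (card (S \<inter> branch_locus_upto I \<phi> X)) / real (card (branch_locus_upto I \<phi> X))) at_top"
    by (intro eventually_mono[OF eventually_ge_at_top[of 0]]) (simp add: card_positive_box)
  ultimately show ?thesis
    unfolding has_relative_density_def by (rule Lim_transform_eventually)
qed

theorem theorem1p3:
  fixes w :: "'n::finite \<Rightarrow> nat"
    and I :: "'i set"
    and a :: "'n \<Rightarrow> 'i \<Rightarrow> rat"
  assumes "CARD('n) \<ge> 2"
    and "\<And>i. w i > 0"
    and "\<And>i \<alpha>. \<alpha> \<in> I \<Longrightarrow> a i \<alpha> > 0"
    and "visibility_datum I (monomial_branch w a)"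
    and "Gcd (range w) = 1"
    and "branch_locus I (monomial_branch w a) = {P. \<forall>i. P $ i \<ge> 1}"
  shows "(\<forall>p. prime p \<longrightarrow>
            has_relative_density I (monomial_branch w a)
              (padically_visible p I (monomial_branch w a))
              (1 - 1 / real p ^ (\<Sum>i\<in>UNIV. w i))) \<and>
         has_relative_density I (monomial_branch w a)
           (globally_visible I (monomial_branch w a))
           (1 / riemann_zeta (real (\<Sum>i\<in>UNIV. w i)))"
proof (intro conjI allI impI)
  let ?\<phi> = "monomial_branch w a"
  note locus = assms(6)
  have pos: "positive_box N \<subseteq> branch_locus I ?\<phi>" for N by (auto simp: locus positive_box_def)
  show "has_relative_density I ?\<phi> (padically_visible p I ?\<phi>) (1 - 1 / real p ^ (\<Sum>i\<in>UNIV. w i))"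
    if p: "prime p" for p
  proof (rule has_relative_density_of_boxes[OF locus])
    have "padically_visible p I ?\<phi> \<inter> positive_box N = {P \<in> positive_box N. \<not> weighted_dvd w p P}" for N
      using pos padically_visible_eq[where w = w and a = a, OF assms(2,5,3) p] by blast
    then show "(\<lambda>N. real (card (padically_visible p I ?\<phi> \<inter> positive_box N)) / real N ^ CARD('n))
        \<longlonglongrightarrow> 1 - 1 / real p ^ (\<Sum>i\<in>UNIV. w i)"
      using density_not_weighted_multiples[of p w] prime_gt_0_nat[OF p] by simp
  qed
  have "(\<Sum>i\<in>(UNIV :: 'n set). 1) \<le> (\<Sum>i\<in>UNIV. w i)"
    using assms(2) by (intro sum_mono) (simp add: Suc_leI)
  then have W: "(\<Sum>i\<in>UNIV. w i) \<ge> 2" using assms(1) by simp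
  show "has_relative_density I ?\<phi> (globally_visible I ?\<phi>) (1 / riemann_zeta (real (\<Sum>i\<in>UNIV. w i)))"
  proof (rule has_relative_density_of_boxes[OF locus])
    have "globally_visible I ?\<phi> \<inter> positive_box N = {P \<in> positive_box N. \<forall>k\<ge>2. \<not> weighted_dvd w k P}" for N
      using pos globally_visible_eq[where w = w and a = a, OF assms(5,3)] by blast
    then show "(\<lambda>N. real (card (globally_visible I ?\<phi> \<inter> positive_box N)) / real N ^ CARD('n))
        \<longlonglongrightarrow> 1 / riemann_zeta (real (\<Sum>i\<in>UNIV. w i))"
      using density_weighted_primitive[where w = w, OF assms(2) W] by simp
  qed
qed

end
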